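(* Let $A\in\mathbb{R}[\mathtt{x}]^{\alpha\times\alpha}$ be a linear pencil in the variables $\mathtt{x}=(\mathtt{x}_1,\dots,\mathtt{x}_n)$. Then $$S_A\text{ is bounded}\quad\Longleftrightarrow\quad M_A\text{ is archimedean.}$$
   Context: Let $\mathtt{x}=(\mathtt{x}_1,\dots,\mathtt{x}_n)$ be commuting variables and $\mathbb{R}[\mathtt{x}]$ the polynomial ring. A linear pencil of size $\alpha$ is a symmetric matrix $A\in\mathbb{R}[\mathtt{x}]^{\alpha\times\alpha}$ whose entries have degree at most $1$; its spectrahedron is $S_A:=\{x\in\mathbb{R}^n\mid A(x)\succeq0\}$ ($\succeq0$ means positive semidefinite; $S_A$ may be empty, and the empty set counts as bounded). The quadratic module associated to $A$ is $$M_A:=\Big\{s+\sum_iv_i^*Av_i\ \Big|\ s\in\sum\mathbb{R}[\mathtt{x}]^2,\ v_i\in\mathbb{R}[\mathtt{x}]^\alpha\Big\}\subseteq\mathbb{R}[\mathtt{x}]$$ (finite sums; $^*$ is transpose; $\sum\mathbb{R}[\mathtt{x}]^2$ is the set of finite sums of squares). A quadratic module in $\mathbb{R}[\mathtt{x}]$ is a subset containing $1$ and closed under addition and under multiplication by squares of elements of $\mathbb{R}[\mathtt{x}]$. A quadratic module $M\subseteq\mathbb{R}[\mathtt{x}]$ is archimedean if for every $f\in\mathbb{R}[\mathtt{x}]$ there is $N\in\mathbb{N}$ with $N+f\in M$ (equivalently, for each $i\in\{1,\dots,n\}$ there is $N\in\mathbb{N}$ with $N\pm\mathtt{x}_i\in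 M$). *)

theory Defs
  imports "HOL-Analysis.Analysis" "HOL-Library.Poly_Mapping"
begin

section \<open>Real polynomials in finitely many variables\<close>

text \<open>
  Monomials are exponent vectors \<open>'n \<Rightarrow>\<^sub>0 nat\<close>, where the finite type \<open>'n\<close> indexes the
  variables; a polynomial maps monomials to their coefficients. Multiplication of type
  \<open>'n rpoly\<close> is convolution over the monomials, i.e. multiplication of polynomials.
\<close>

type_synonym 'n rpoly = "('n \<Rightarrow>\<^sub>0 nat) \<Rightarrow>\<^sub>0 real"

definition peval :: "('n::finite) rpoly \<Rightarrow> real ^ 'n \<Rightarrow> real" where
  "peval p x =
     (\<Sum>m\<in>Poly_Mapping.keys p. Poly_Mapping.lookup p m * (\<Prod>i\<in>UNIV. (x $ i) ^ Poly_Mapping.lookup m i))"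

text \<open>Total degree, with value 0 at the zero polynomial.\<close>

definition total_degree :: "('n::finite) rpoly \<Rightarrow> nat" where
  "total_degree p = Max (insert 0 ((\<lambda>m. \<Sum>i\<in>UNIV. Poly_Mapping.lookup m i) ` Poly_Mapping.keys p))"

definition sums_of_squares :: "('n::finite) rpoly set" where
  "sums_of_squares = {s. \<exists>(k::nat) g. s = (\<Sum>i<k. (g i)\<^sup>2)}"


section \<open>Linear pencils and spectrahedra\<close>

definition linear_pencil :: "('n::finite) rpoly ^ 'a ^ 'a \<Rightarrow> bool" where
  "linear_pencil A \<longleftrightarrow> transpose A = A \<and> (\<forall>i j. total_degree (A $ i $ j) \<le> 1)"

definition pencil_eval :: "('n::finite) rpoly ^ 'a ^ 'a \<Rightarrow> real ^ 'n \<Rightarrow> real ^ 'a ^ 'a" where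
  "pencil_eval A x = (\<chi> i j. peval (A $ i $ j) x)"

definition pos_semidef :: "real ^ 'a ^ 'a \<Rightarrow> bool" where
  "pos_semidef B \<longleftrightarrow> transpose B = B \<and> (\<forall>v. 0 \<le> v \<bullet> (B *v v))"

definition spectrahedron :: "('n::finite) rpoly ^ 'a ^ 'a \<Rightarrow> (real ^ 'n) set" where
  "spectrahedron A = {x. pos_semidef (pencil_eval A x)}"


section \<open>Quadratic modules\<close>

definition quadratic_module :: "('n::finite) rpoly set \<Rightarrow> bool" where
  "quadratic_module M \<longleftrightarrow>
     1 \<in> M \<and> (\<forall>f\<in>M. \<forall>g\<in>M. f + g \<in> M) \<and> (\<forall>f\<in>M. \<forall>h. h\<^sup>2 * f \<in> M)"

definition archimedean :: "('n::finite) rpoly set \<Rightarrow> bool" where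
  "archimedean M \<longleftrightarrow> quadratic_module M \<and> (\<forall>f. \<exists>N::nat. of_nat N + f \<in> M)"

definition pencil_module :: "('n::finite) rpoly ^ 'a ^ 'a \<Rightarrow> 'n rpoly set" where
  "pencil_module A =
     {s + (\<Sum>i<k. scalar_product (v i) (A *v v i)) | s (k::nat) v. s \<in> sums_of_squares}"

lemma sum_lessThan_append:
  fixes f :: "'b \<Rightarrow> 'c::comm_monoid_add" and k l :: nat
  shows "(\<Sum>i<k. f (u i)) + (\<Sum>i<l. f (w i)) = (\<Sum>i<k + l. f (if i < k then u i else w (i - k)))"
  by (induction l) (simp_all add: add.assoc[symmetric])

lemma pencil_moduleI:
  fixes k l :: nat
  assumes "f = (\<Sum>i<k. (p i)\<^sup>2) + (\<Sum>i<l. scalar_product (v i) (A *v v i))"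
  shows "f \<in> pencil_module A"
  using assms unfolding pencil_module_def sums_of_squares_def by blast

text \<open>The quadratic-module conjunct of \<open>archimedean\<close> is automatic for \<open>pencil_module A\<close>.\<close>

lemma quadratic_module_pencil_module: "quadratic_module (pencil_module A)"
  unfolding quadratic_module_def
proof (intro conjI ballI allI)
  have "1 = (\<Sum>i<1::nat. 1\<^sup>2) + (\<Sum>i<0::nat. scalar_product 0 (A *v 0))"
    by simp
  then show "1 \<in> pencil_module A"
    by (rule pencil_moduleI)
next
  fix f g assume "f \<in> pencil_module A" "g \<in> pencil_module A"
  then obtain k p l v k' p' l' v' where
    f: "f = (\<Sum>i<k::nat. (p i)\<^sup>2) + (\<Sum>i<l::nat. scalar_product (v i) (A *v v i))" and
    g: "g = (\<Sum>i<k'::nat. (p' i)\<^sup>2) + (\<Sum>i<l'::nat. scalar_product (v' i) (A *v v' i))"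
    unfolding pencil_module_def sums_of_squares_def by blast
  have "f + g = ((\<Sum>i<k. (p i)\<^sup>2) + (\<Sum>i<k'. (p' i)\<^sup>2)) +
      ((\<Sum>i<l. scalar_product (v i) (A *v v i)) + (\<Sum>i<l'. scalar_product (v' i) (A *v v' i)))"
    by (simp add: f g add_ac)
  also have "\<dots> = (\<Sum>i<k + k'. (if i < k then p i else p' (i - k))\<^sup>2) +
      (\<Sum>i<l + l'. scalar_product (if i < l then v i else v' (i - l))
         (A *v (if i < l then v i else v' (i - l))))"
    using sum_lessThan_append[of "\<lambda>q. q\<^sup>2" p k p' k']
      sum_lessThan_append[of "\<lambda>w. scalar_product w (A *v w)" v l v' l'] by simp
  finally show "f + g \<in> pencil_module A"
    by (rule pencil_moduleI)
next
  fix f h assume "f \<in> pencil_module A"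
  then obtain k p l v where
    f: "f = (\<Sum>i<k::nat. (p i)\<^sup>2) + (\<Sum>i<l::nat. scalar_product (v i) (A *v v i))"
    unfolding pencil_module_def sums_of_squares_def by blast
  have *: "scalar_product (h *s w) (A *v (h *s w)) = h\<^sup>2 * scalar_product w (A *v w)" for w
    by (simp add: scalar_product_def matrix_vector_mult_def sum_distrib_left
        power2_eq_square algebra_simps)
  have "h\<^sup>2 * f = (\<Sum>i<k. (h * p i)\<^sup>2) + (\<Sum>i<l. scalar_product (h *s v i) (A *v (h *s v i)))"
    by (simp add: f * distrib_left sum_distrib_left power_mult_distrib)
  then show "h\<^sup>2 * f \<in> pencil_module A"
    by (rule pencil_moduleI)
qed

end

theory Submission
  imports Defs
begin

text \<open>
  If the spectrahedron is nonempty and bounded, an affine polynomial that is positive on it lies in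
  the module: a separating functional \<open>(t, y)\<close> would give the point \<open>y / t\<close> of the
  spectrahedron if \<open>t > 0\<close>, and a recession direction if \<open>t = 0\<close>.

  If it is empty, \<open>-1\<close> has to be produced. Let \<open>N\<close> be any quadratic module containing that of
  the pencil and \<open>L\<close> the space of affine polynomials \<open>l\<close> with \<open>\<plusminus>l \<in> N\<close>. Compactness and
  separation on the zero set of \<open>L\<close> yield either \<open>1 \<in> L\<close> or a unit vector \<open>u\<close> with
  \<open>u\<^sup>T A u \<in> L\<close>. If \<open>u\<^sup>T A w \<in> L\<close> for all test vectors \<open>w\<close>, then \<open>u\<close> can be dropped. Otherwise
  adjoin some \<open>l = u\<^sup>T A w\<close> outside \<open>L\<close> to the support, so that inductively \<open>-1 - p l \<in> N\<close>
  for some \<open>p\<close>. With \<open>q = w\<^sup>T A w\<close>, all \<open>q + g l\<close> lie in \<open>N\<close>, and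
  \<open>(q + 1)\<^sup>2 (-1 - p l) + (q + (q + 1)\<^sup>2 p l) + q + q\<^sup>2 = -1\<close>.
\<close>

section \<open>Polynomials and their evaluation\<close>

lemma poly_mapping_sum_single:
  fixes p :: "'k \<Rightarrow>\<^sub>0 'c::comm_monoid_add"
  shows "p = (\<Sum>m\<in>Poly_Mapping.keys p. Poly_Mapping.single m (Poly_Mapping.lookup p m))"
  by (rule poly_mapping_eqI)
    (auto simp: lookup_sum lookup_single when_def sum.delta in_keys_iff)

text \<open>Monomials outside the support contribute zero, so polynomials with different supports
  can be evaluated over one common index set.\<close>

lemma peval_superset:
  assumes "finite S" "Poly_Mapping.keys p \<subseteq> S"
  shows "peval p x =
    (\<Sum>m\<in>S. Poly_Mapping.lookup p m * (\<Prod>i\<in>UNIV. (x $ i) ^ Poly_Mapping.lookup m i))"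
  unfolding peval_def using assms
  by (intro sum.mono_neutral_left) (auto simp: in_keys_iff)

lemma peval_zero [simp]: "peval 0 x = 0"
  by (simp add: peval_def)

lemma peval_add [simp]: "peval (p + q) x = peval p x + peval q x"
proof -
  let ?S = "Poly_Mapping.keys p \<union> Poly_Mapping.keys q"
  have "Poly_Mapping.keys (p + q) \<subseteq> ?S"
    by (rule keys_add)
  then show ?thesis
    by (simp add: peval_superset[of ?S] lookup_add distrib_right sum.distrib)
qed

lemma peval_uminus [simp]: "peval (- p) x = - peval p x"
  using peval_add[of p "- p" x] by simp

lemma peval_sum [simp]: "peval (\<Sum>i\<in>I. f i) x = (\<Sum>i\<in>I. peval (f i) x)"
  by (induction I rule: infinite_finite_induct) auto

lemma peval_single [simp]:
  "peval (Poly_Mapping.single m c) x = c * (\<Prod>i\<in>UNIV. (x $ i) ^ Poly_Mapping.lookup m i)"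
  by (simp add: peval_superset[of "{m}"])

lemma peval_mult [simp]: "peval (p * q) x = peval p x * peval q x"
proof -
  have "peval (Poly_Mapping.single m c * Poly_Mapping.single k d) x =
      peval (Poly_Mapping.single m c) x * peval (Poly_Mapping.single k d) x"
    for m k :: "'a \<Rightarrow>\<^sub>0 nat" and c d
    by (simp add: mult_single lookup_add power_add prod.distrib)
  \<comment> \<open>Bilinearity carries the rule from monomials to sums; arbitrary coefficients
    allow the expansions of \<open>p\<close> and \<open>q\<close> to be folded back at the
    end.\<close>
  then have "peval ((\<Sum>m\<in>S. Poly_Mapping.single m (f m)) * (\<Sum>k\<in>T. Poly_Mapping.single k (g k))) x =
      peval (\<Sum>m\<in>S. Poly_Mapping.single m (f m)) x * peval (\<Sum>k\<in>T. Poly_Mapping.single k (g k)) x"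
    for S T :: "('a \<Rightarrow>\<^sub>0 nat) set" and f g
    by (simp only: sum_product peval_sum)
  from this[of "Poly_Mapping.lookup p" "Poly_Mapping.keys p" "Poly_Mapping.lookup q" "Poly_Mapping.keys q"]
  show ?thesis
    by (simp only: poly_mapping_sum_single[symmetric])
qed

definition pconst :: "real \<Rightarrow> ('n::finite) rpoly" where
  "pconst c = Poly_Mapping.single 0 c"

lemma pconst_0 [simp]: "pconst 0 = 0"
  and pconst_1 [simp]: "pconst 1 = 1"
  and pconst_add: "pconst (c + d) = pconst c + pconst d"
  and pconst_mult: "pconst (c * d) = pconst c * pconst d"
  and pconst_uminus: "pconst (- c) = - pconst c"
  and pconst_diff: "pconst (c - d) = pconst c - pconst d"
  and pconst_of_nat: "pconst (of_nat k) = of_nat k"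
  and peval_pconst [simp]: "peval (pconst c) x = c"
  by (auto simp: pconst_def single_add single_uminus single_diff mult_single)

lemma peval_one [simp]: "peval 1 x = 1"
  using peval_pconst[of 1 x] by simp

lemma peval_power [simp]: "peval (p ^ k) x = peval p x ^ k"
  by (induction k) auto

section \<open>Affine polynomials\<close>

text \<open>The pair \<open>(c, b)\<close> stands for the affine polynomial with constant term \<open>c\<close> and linear
  coefficients \<open>b\<close>, so that its value at \<open>x\<close> is the inner product with \<open>(1, x)\<close>.\<close>

definition pvar :: "'n \<Rightarrow> ('n::finite) rpoly" where
  "pvar i = Poly_Mapping.single (Poly_Mapping.single i 1) 1"

definition affpoly :: "real \<times> (real ^ 'n) \<Rightarrow> ('n::finite) rpoly" where
  "affpoly z = pconst (fst z) + (\<Sum>i\<in>UNIV. pconst (snd z $ i) * pvar i)"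

text \<open>Terms of degree two or more are dropped, so \<open>affpoly\<close> recovers
  \<open>p\<close> from these data only in degree at most 1.\<close>

definition affcoeffs :: "('n::finite) rpoly \<Rightarrow> real \<times> (real ^ 'n)" where
  "affcoeffs p =
     (Poly_Mapping.lookup p 0, \<chi> i. Poly_Mapping.lookup p (Poly_Mapping.single i 1))"

lemma affpoly_add: "affpoly (z + w) = affpoly z + affpoly w"
  by (simp add: affpoly_def pconst_add distrib_right sum.distrib algebra_simps)

lemma affpoly_scaleR: "affpoly (r *\<^sub>R z) = pconst r * affpoly z"
  by (simp add: affpoly_def pconst_mult distrib_left sum_distrib_left mult.assoc)

lemma affpoly_0 [simp]: "affpoly 0 = 0"
  by (simp add: affpoly_def)

lemma affpoly_uminus: "affpoly (- z) = - affpoly z"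
  using affpoly_scaleR[of "-1" z] by (simp add: pconst_uminus)

lemma affpoly_sum: "affpoly (\<Sum>i\<in>I. f i) = (\<Sum>i\<in>I. affpoly (f i))"
  by (induction I rule: infinite_finite_induct) (auto simp: affpoly_add)

lemma affpoly_const [simp]: "affpoly (c, 0) = pconst c"
  by (simp add: affpoly_def)

lemma peval_pvar [simp]: "peval (pvar i) x = x $ i"
proof -
  have "(\<Prod>j\<in>UNIV. (x $ j) ^ (if j = i then 1 else 0)) = x $ i"
    by (subst prod.remove[of _ i]) (auto intro!: prod.neutral)
  moreover have "(\<lambda>j. (x $ j) ^ Poly_Mapping.lookup (Poly_Mapping.single i 1) j) =
      (\<lambda>j. (x $ j) ^ (if j = i then 1 else 0))"
    by (auto simp: lookup_single when_def)
  ultimately show ?thesis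
    by (simp only: pvar_def peval_single mult_1)
qed

lemma peval_affpoly: "peval (affpoly z) x = z \<bullet> (1, x)"
  by (cases z) (simp add: affpoly_def inner_vec_def)

lemma affpoly_axis: "affpoly (c, axis i r) = pconst c + pconst r * pvar i"
proof -
  have "(\<Sum>j\<in>UNIV. pconst (axis i r $ j) * pvar j) =
      (\<Sum>j\<in>UNIV. if j = i then pconst r * pvar j else (0 :: 'a rpoly))"
    by (rule sum.cong) (auto simp: axis_def)
  then show ?thesis
    by (simp add: affpoly_def)
qed

lemma keys_total_degree_le_1:
  assumes "total_degree p \<le> 1" "m \<in> Poly_Mapping.keys p"
  shows "m = 0 \<or> (\<exists>i. m = Poly_Mapping.single i 1)"
proof (cases "m = 0")
  case False
  have "(\<Sum>i\<in>UNIV. Poly_Mapping.lookup m i) \<le> total_degree p"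
    unfolding total_degree_def using assms(2) by (intro Max_ge) auto
  then have le: "(\<Sum>i\<in>UNIV. Poly_Mapping.lookup m i) \<le> 1"
    using assms(1) by simp
  obtain i where i: "Poly_Mapping.lookup m i \<noteq> 0"
    using False by (metis lookup_zero poly_mapping_eqI)
  have split: "(\<Sum>i\<in>UNIV. Poly_Mapping.lookup m i) =
      Poly_Mapping.lookup m i + (\<Sum>j\<in>UNIV - {i}. Poly_Mapping.lookup m j)"
    by (simp add: sum.remove)
  have rest: "(\<Sum>j\<in>UNIV - {i}. Poly_Mapping.lookup m j) = 0"
    and "Poly_Mapping.lookup m i = 1"
    using i le split by linarith+
  moreover from rest have "Poly_Mapping.lookup m j = 0" if "j \<noteq> i" for j
    using that by simp
  ultimately have "m = Poly_Mapping.single i 1"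
    by (intro poly_mapping_eqI) (auto simp: lookup_single when_def)
  then show ?thesis by blast
qed simp

lemma affpoly_affcoeffs:
  assumes "total_degree p \<le> 1"
  shows "affpoly (affcoeffs p) = p"
proof (rule poly_mapping_eqI)
  fix m
  have single_neq: "Poly_Mapping.single i (1::nat) \<noteq> 0" for i :: 'a
    by (metis lookup_single_eq lookup_zero zero_neq_one)
  have lk: "Poly_Mapping.lookup (affpoly (affcoeffs p)) m =
      (Poly_Mapping.lookup p 0 when m = 0) +
      (\<Sum>i\<in>UNIV. Poly_Mapping.lookup p (Poly_Mapping.single i 1) when Poly_Mapping.single i 1 = m)"
    by (simp add: affpoly_def affcoeffs_def pconst_def pvar_def mult_single lookup_add
        lookup_sum lookup_single when_def)
  consider "m = 0" | i where "m = Poly_Mapping.single i 1"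
    | "m \<noteq> 0" "\<forall>i. m \<noteq> Poly_Mapping.single i 1" by blast
  then show "Poly_Mapping.lookup (affpoly (affcoeffs p)) m = Poly_Mapping.lookup p m"
  proof cases
    case 1
    then show ?thesis
      unfolding lk using single_neq by simp
  next
    case (2 i)
    have "(Poly_Mapping.single j (1::nat) = Poly_Mapping.single i 1) = (j = i)" for j
      by (metis lookup_single_eq lookup_single_not_eq zero_neq_one)
    then have "(\<Sum>j\<in>UNIV. Poly_Mapping.lookup p (Poly_Mapping.single j 1) when
          Poly_Mapping.single j 1 = m) =
        (\<Sum>j\<in>UNIV. if j = i then Poly_Mapping.lookup p (Poly_Mapping.single j 1) else 0)"
      unfolding 2 by (intro sum.cong) (auto simp: when_def)
    also have "\<dots> = Poly_Mapping.lookup p m"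
      by (simp add: 2)
    finally show ?thesis
      unfolding lk using single_neq[of i] 2 by simp
  next
    case 3
    then have "m \<notin> Poly_Mapping.keys p"
      using keys_total_degree_le_1[OF assms] by blast
    then show ?thesis
      unfolding lk using 3(1) 3(2)[THEN spec, THEN not_sym] by (simp add: in_keys_iff)
  qed
qed

section \<open>Quadratic modules\<close>

lemma pconst_half: "pconst (1/2) + pconst (1/2) = 1"
  by (simp flip: pconst_add)

context
  fixes N :: "('n::finite) rpoly set"
  assumes N: "quadratic_module N"
begin

lemma qm_1: "1 \<in> N"
  and qm_add: "f \<in> N \<Longrightarrow> g \<in> N \<Longrightarrow> f + g \<in> N"
  and qm_square_mult: "f \<in> N \<Longrightarrow> h\<^sup>2 * f \<in> N"
  using N by (auto simp: quadratic_module_def)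

lemma qm_square: "h\<^sup>2 \<in> N"
  using qm_square_mult[OF qm_1, of h] by simp

lemma qm_0: "0 \<in> N"
  using qm_square[of 0] by simp

lemma qm_scale:
  assumes "0 \<le> c" "f \<in> N"
  shows "pconst c * f \<in> N"
proof -
  have "(pconst (sqrt c))\<^sup>2 = pconst c"
    using assms(1) by (simp add: power2_eq_square flip: pconst_mult)
  then show ?thesis
    using qm_square_mult[OF assms(2)] by metis
qed

lemma qm_pconst: "0 \<le> c \<Longrightarrow> pconst c \<in> N"
  using qm_scale[OF _ qm_1] by simp

text \<open>The support of a quadratic module is an ideal, since
  \<open>g = ((g + 1)/2)^2 - ((g - 1)/2)^2\<close> and both \<open>f\<close> and \<open>- f\<close>
  may be multiplied by squares.\<close>

lemma qm_support_mult:
  assumes "f \<in> N" "- f \<in> N"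
  shows "g * f \<in> N"
proof -
  let ?h = "pconst (1/2)"
  have "(?h * (g + 1))\<^sup>2 * f + (?h * (g - 1))\<^sup>2 * (- f) = (?h + ?h)\<^sup>2 * (g * f)"
    by (simp add: power2_eq_square algebra_simps)
  also have "\<dots> = g * f"
    by (simp only: pconst_half) simp
  finally show ?thesis
    using qm_add[OF qm_square_mult[OF assms(1)] qm_square_mult[OF assms(2)]] by metis
qed

lemma qm_eq_UNIV:
  assumes "- 1 \<in> N"
  shows "f \<in> N"
  using qm_support_mult[OF qm_1 assms, of f] by simp

text \<open>This is the quadratic module generated by \<open>N\<close>, \<open>l\<close> and
  \<open>- l\<close>; it serves to force \<open>l\<close> into the support.\<close>

lemma quadratic_module_adjoin: "quadratic_module {f + g * l | f g. f \<in> N}"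
  unfolding quadratic_module_def
proof (intro conjI ballI allI)
  have "1 = 1 + 0 * l" by simp
  then show "1 \<in> {f + g * l | f g. f \<in> N}" using qm_1 by blast
next
  fix p q assume "p \<in> {f + g * l | f g. f \<in> N}" "q \<in> {f + g * l | f g. f \<in> N}"
  then obtain f g f' g' where "p = f + g * l" "q = f' + g' * l" "f \<in> N" "f' \<in> N"
    by blast
  then have "p + q = (f + f') + (g + g') * l" "f + f' \<in> N"
    by (auto simp: algebra_simps intro: qm_add)
  then show "p + q \<in> {f + g * l | f g. f \<in> N}" by blast
next
  fix p h assume "p \<in> {f + g * l | f g. f \<in> N}"
  then obtain f g where "p = f + g * l" "f \<in> N"
    by blast
  then have "h\<^sup>2 * p = h\<^sup>2 * f + (h\<^sup>2 * g) * l" "h\<^sup>2 * f \<in> N"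
    by (simp add: algebra_simps) (rule qm_square_mult, fact)
  then show "h\<^sup>2 * p \<in> {f + g * l | f g. f \<in> N}" by blast
qed

lemma qm_eliminate:
  assumes "- 1 - p * l \<in> N" and q: "\<And>g. q + g * l \<in> N"
  shows "- 1 \<in> N"
proof -
  \<comment> \<open>The multiplier of \<open>l\<close> in the second summand is chosen to cancel
    \<open>p * l\<close>; what remains is \<open>- (q + 1)^2 + 2 q + q^2\<close>.\<close>
  have "(q + 1)\<^sup>2 * (- 1 - p * l) + (q + ((q + 1)\<^sup>2 * p) * l) + (q + 0 * l) + q\<^sup>2 \<in> N"
    by (intro qm_add qm_square_mult assms qm_square)
  moreover have "(q + 1)\<^sup>2 * (- 1 - p * l) + (q + ((q + 1)\<^sup>2 * p) * l) + (q + 0 * l) + q\<^sup>2 = - 1"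
    by (simp add: power2_eq_square algebra_simps)
  ultimately show ?thesis by metis
qed

section \<open>Elements bounded relative to a quadratic module\<close>

lemma qm_bounded_add:
  assumes "pconst b - f \<in> N" "pconst b + f \<in> N" "pconst c - g \<in> N" "pconst c + g \<in> N"
  shows "pconst (b + c) - (f + g) \<in> N" "pconst (b + c) + (f + g) \<in> N"
  using qm_add[OF assms(1,3)] qm_add[OF assms(2,4)]
  by (simp_all add: pconst_add algebra_simps)

text \<open>The certificate is
  \<open>(b + f)^2 (b - f) + (b - f)^2 (b + f) = 2 b (b^2 - f^2)\<close>, divided by the positive
  number \<open>2 b\<close>.\<close>

lemma qm_bounded_square:
  assumes "0 < b" "pconst b - f \<in> N" "pconst b + f \<in> N"
  shows "pconst (b\<^sup>2) - f\<^sup>2 \<in> N"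
proof -
  define B :: "'n rpoly" where "B = pconst b"
  have "pconst (1 / (2 * b)) * ((B + f)\<^sup>2 * (B - f) + (B - f)\<^sup>2 * (B + f)) \<in> N"
    using assms
    by (intro qm_scale qm_add[OF qm_square_mult qm_square_mult]) (auto simp: B_def)
  also have "(B + f)\<^sup>2 * (B - f) + (B - f)\<^sup>2 * (B + f) = pconst (2 * b) * (B\<^sup>2 - f\<^sup>2)"
    unfolding mult_2 pconst_add B_def[symmetric] by (simp add: power2_eq_square algebra_simps)
  also have "pconst (1 / (2 * b)) * (pconst (2 * b) * (B\<^sup>2 - f\<^sup>2)) = B\<^sup>2 - f\<^sup>2"
    using assms(1) by (simp flip: mult.assoc pconst_mult)
  finally show ?thesis
    by (simp add: B_def power2_eq_square pconst_mult)
qed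

text \<open>The bound is taken positive because \<open>qm_bounded_square\<close> divides by it; any
  bound can be enlarged to a positive one.\<close>

definition qm_bounded :: "'n rpoly \<Rightarrow> bool" where
  "qm_bounded f \<longleftrightarrow> (\<exists>b>0. pconst b - f \<in> N \<and> pconst b + f \<in> N)"

lemma qm_boundedI:
  assumes "pconst b - f \<in> N" "pconst c + f \<in> N"
  shows "qm_bounded f"
proof -
  let ?d = "max (max b c) 1"
  have "pconst (?d - b) + (pconst b - f) \<in> N" "pconst (?d - c) + (pconst c + f) \<in> N"
    using assms by (auto intro!: qm_add qm_pconst)
  then show ?thesis
    unfolding qm_bounded_def by (intro exI[of _ ?d]) (simp add: pconst_diff)
qed

lemma qm_bounded_plus: "qm_bounded f \<Longrightarrow> qm_bounded g \<Longrightarrow> qm_bounded (f + g)"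
  unfolding qm_bounded_def using qm_bounded_add add_pos_pos by meson

lemma qm_bounded_uminus: "qm_bounded f \<Longrightarrow> qm_bounded (- f)"
  by (auto simp: qm_bounded_def)

lemma qm_bounded_pconst: "qm_bounded (pconst c)"
  using qm_0 by (intro qm_boundedI[of c _ "- c"]) (auto simp: pconst_uminus)

lemma qm_bounded_sq:
  assumes "qm_bounded f"
  shows "qm_bounded (f\<^sup>2)"
proof -
  obtain b where "pconst (b\<^sup>2) - f\<^sup>2 \<in> N"
    using assms qm_bounded_square by (auto simp: qm_bounded_def)
  moreover have "pconst 0 + f\<^sup>2 \<in> N"
    using qm_square by simp
  ultimately show ?thesis by (rule qm_boundedI)
qed

text \<open>Polarization, \<open>f g = ((f + g)/2)^2 - ((f - g)/2)^2\<close>, reduces products to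
  squares.\<close>

lemma qm_bounded_mult:
  assumes "qm_bounded f" "qm_bounded g"
  shows "qm_bounded (f * g)"
proof -
  have half: "qm_bounded (pconst (1/2) * h)" if h: "qm_bounded h" for h
  proof -
    obtain b where "pconst b - h \<in> N" "pconst b + h \<in> N"
      using h by (auto simp: qm_bounded_def)
    then have "pconst (1/2) * (pconst b - h) \<in> N" "pconst (1/2) * (pconst b + h) \<in> N"
      by (auto intro: qm_scale)
    then show ?thesis
      by (intro qm_boundedI[of "1/2 * b" _ "1/2 * b"])
        (simp_all only: pconst_mult right_diff_distrib distrib_left)
  qed
  let ?h = "pconst (1/2)"
  have "qm_bounded ((?h * (f + g))\<^sup>2 + - ((?h * (f + - g))\<^sup>2))"
    by (intro qm_bounded_plus qm_bounded_uminus qm_bounded_sq half assms)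
  also have "(?h * (f + g))\<^sup>2 + - ((?h * (f + - g))\<^sup>2) = (?h + ?h)\<^sup>2 * (f * g)"
    by (simp add: power2_eq_square algebra_simps)
  also have "\<dots> = f * g"
    by (simp only: pconst_half) simp
  finally show ?thesis .
qed

lemma qm_bounded_single:
  assumes "\<And>i. qm_bounded (pvar i)"
  shows "qm_bounded (Poly_Mapping.single m c)"
proof -
  have pow: "qm_bounded (Poly_Mapping.single (Poly_Mapping.single i k) 1)" for i k
  proof (induction k)
    case 0
    then show ?case using qm_bounded_pconst[of 1] by (simp add: pconst_def)
  next
    case (Suc k)
    have "Poly_Mapping.single (Poly_Mapping.single i (Suc k)) 1 =
        pvar i * Poly_Mapping.single (Poly_Mapping.single i k) (1::real)"
      by (simp add: pvar_def mult_single flip: single_add)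
    then show ?case using qm_bounded_mult[OF assms Suc] by metis
  qed
  have "qm_bounded (Poly_Mapping.single (\<Sum>i\<in>S. Poly_Mapping.single i (k i)) 1)" for S k
  proof (induction S rule: infinite_finite_induct)
    case (insert i S)
    have "Poly_Mapping.single (\<Sum>i\<in>insert i S. Poly_Mapping.single i (k i)) 1 =
        Poly_Mapping.single (Poly_Mapping.single i (k i)) 1 *
        Poly_Mapping.single (\<Sum>i\<in>S. Poly_Mapping.single i (k i)) (1::real)"
      using insert by (simp add: mult_single)
    then show ?case using qm_bounded_mult[OF pow insert.IH] by metis
  qed (use qm_bounded_pconst[of 1] in \<open>simp_all add: pconst_def\<close>)
  then have "qm_bounded (Poly_Mapping.single m 1)"
    using poly_mapping_sum_single[of m] by metis
  from qm_bounded_mult[OF qm_bounded_pconst[of c] this] show ?thesis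
    by (simp add: pconst_def mult_single)
qed

text \<open>Bounded elements form a subring containing the real constants, so it is enough to bound
  its generators, the variables.\<close>

lemma archimedeanI_pvar:
  assumes "\<And>i. qm_bounded (pvar i)"
  shows "archimedean N"
  unfolding archimedean_def
proof (intro conjI allI N)
  fix f
  have "qm_bounded (\<Sum>m\<in>S. Poly_Mapping.single m (c m))" for S and c :: "_ \<Rightarrow> real"
    by (induction S rule: infinite_finite_induct)
      (use qm_bounded_pconst[of 0] in \<open>simp_all add: qm_bounded_plus qm_bounded_single assms\<close>)
  then have "qm_bounded f"
    using poly_mapping_sum_single[of f] by metis
  then obtain b where b: "pconst b + f \<in> N"
    by (auto simp: qm_bounded_def)
  obtain k :: nat where "b \<le> of_nat k"
    using real_arch_simple by blast
  then have "pconst (of_nat k - b) + (pconst b + f) \<in> N"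
    using b by (intro qm_add[OF qm_pconst b]) simp
  then show "\<exists>k::nat. of_nat k + f \<in> N"
    by (auto simp: pconst_diff pconst_of_nat)
qed

end

section \<open>The pencil as a bilinear form with affine values\<close>

text \<open>The affine polynomial \<open>u^T A w\<close>, kept as a coefficient pair so that
  separation and dimension arguments in a Euclidean space apply.\<close>

definition aform :: "('n::finite) rpoly ^ 'a ^ 'a \<Rightarrow> real ^ 'a \<Rightarrow> real ^ 'a::finite \<Rightarrow> real \<times> (real ^ 'n)"
  where "aform A u w = (\<Sum>i\<in>UNIV. \<Sum>j\<in>UNIV. (u $ i * w $ j) *\<^sub>R affcoeffs (A $ i $ j))"

definition constvec :: "real ^ 'a \<Rightarrow> ('n::finite) rpoly ^ 'a" where
  "constvec u = (\<chi> i. pconst (u $ i))"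

lemma aform_add_left: "aform A (u + v) w = aform A u w + aform A v w"
  by (simp add: aform_def algebra_simps sum.distrib)

lemma aform_add_right: "aform A w (u + v) = aform A w u + aform A w v"
  by (simp add: aform_def algebra_simps sum.distrib)

lemma aform_scaleR_left: "aform A (r *\<^sub>R u) w = r *\<^sub>R aform A u w"
  by (simp add: aform_def scaleR_sum_right mult.assoc)

lemma aform_scaleR_right: "aform A w (r *\<^sub>R u) = r *\<^sub>R aform A w u"
  by (simp add: aform_def scaleR_sum_right mult_ac)

lemma linear_pencil_commute:
  assumes "linear_pencil A"
  shows "A $ i $ j = A $ j $ i"
proof -
  have "transpose A $ i $ j = A $ j $ i"
    by (simp add: transpose_def)
  then show ?thesis
    using assms by (simp add: linear_pencil_def)
qed

lemma aform_commute:
  assumes "linear_pencil A"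
  shows "aform A u w = aform A w u"
  unfolding aform_def
  by (subst sum.swap) (simp add: linear_pencil_commute[OF assms] mult.commute)

lemma affpoly_aform:
  assumes "linear_pencil A"
  shows "affpoly (aform A u w) = scalar_product (constvec u) (A *v constvec w)"
proof -
  have "affpoly (affcoeffs (A $ i $ j)) = A $ i $ j" for i j
    using assms by (intro affpoly_affcoeffs) (simp add: linear_pencil_def)
  then show ?thesis
    by (simp add: aform_def affpoly_sum affpoly_scaleR scalar_product_def matrix_vector_mult_def
        constvec_def sum_distrib_left pconst_mult mult_ac)
qed

lemma peval_scalar_product:
  "peval (scalar_product v (A *v w)) x =
     (\<chi> i. peval (v $ i) x) \<bullet> (pencil_eval A x *v (\<chi> i. peval (w $ i) x))"
  by (simp add: scalar_product_def matrix_vector_mult_def pencil_eval_def inner_vec_def)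

lemma aform_inner:
  assumes "linear_pencil A"
  shows "aform A u w \<bullet> (1, x) = u \<bullet> (pencil_eval A x *v w)"
  using peval_affpoly[of "aform A u w" x]
  by (simp add: affpoly_aform[OF assms] peval_scalar_product constvec_def)

lemma spectrahedron_iff:
  assumes "linear_pencil A"
  shows "x \<in> spectrahedron A \<longleftrightarrow> (\<forall>u. 0 \<le> aform A u u \<bullet> (1, x))"
proof -
  have "transpose (pencil_eval A x) = pencil_eval A x"
    by (simp add: vec_eq_iff transpose_def pencil_eval_def linear_pencil_commute[OF assms])
  then show ?thesis
    by (simp add: spectrahedron_def pos_semidef_def aform_inner[OF assms])
qed

lemma pencil_module_nonneg:
  assumes "x \<in> spectrahedron A" "f \<in> pencil_module A"
  shows "0 \<le> peval f x"
proof -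
  obtain k g l v where
    f: "f = (\<Sum>i<k::nat. (g i)\<^sup>2) + (\<Sum>i<l::nat. scalar_product (v i) (A *v v i))"
    using assms(2) unfolding pencil_module_def sums_of_squares_def by blast
  show ?thesis
    using assms(1) unfolding f
    by (auto simp: peval_scalar_product spectrahedron_def pos_semidef_def
        intro!: add_nonneg_nonneg sum_nonneg)
qed

lemma scalar_product_pencil_add:
  fixes A :: "('n::finite) rpoly ^ 'a ^ 'a::finite"
  shows "scalar_product (v + w) (A *v (v + w)) =
    scalar_product v (A *v v) + scalar_product v (A *v w) +
    (scalar_product w (A *v v) + scalar_product w (A *v w))"
  by (simp add: scalar_product_def matrix_vector_mult_def algebra_simps sum.distrib)

lemma scalar_product_pencil_scale:
  fixes A :: "('n::finite) rpoly ^ 'a ^ 'a::finite"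
  shows "scalar_product (p *s v) (A *v (q *s w)) = p * q * scalar_product v (A *v w)"
  by (simp add: scalar_product_def matrix_vector_mult_def sum_distrib_left mult_ac)

text \<open>The expression is \<open>v^T A v\<close> for the polynomial vector
  \<open>v = p u + q w\<close>. Polynomial weights will later yield arbitrary multiples of
  \<open>u^T A w\<close>.\<close>

lemma aform_in_pencil_module:
  assumes "linear_pencil A"
  shows "p\<^sup>2 * affpoly (aform A u u) + 2 * p * q * affpoly (aform A u w)
    + q\<^sup>2 * affpoly (aform A w w) \<in> pencil_module A" (is "?f \<in> _")
proof (rule pencil_moduleI)
  let ?v = "p *s constvec u + q *s constvec w"
  have "scalar_product ?v (A *v ?v) = p * p * affpoly (aform A u u) + p * q * affpoly (aform A u w)
      + (q * p * affpoly (aform A w u) + q * q * affpoly (aform A w w))"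
    by (simp only: scalar_product_pencil_add scalar_product_pencil_scale affpoly_aform[OF assms])
  also have "\<dots> = ?f"
    by (simp add: aform_commute[OF assms, of w u] power2_eq_square algebra_simps)
  finally show "?f = (\<Sum>i<0::nat. 0\<^sup>2) + (\<Sum>i<1::nat. scalar_product ?v (A *v ?v))"
    by simp
qed

lemma aform_diag_in_pencil_module:
  assumes "linear_pencil A"
  shows "affpoly (aform A u u) \<in> pencil_module A"
  using aform_in_pencil_module[OF assms, of 1 u 0 u] by simp

section \<open>Infeasible pencils\<close>

text \<open>If a convex combination lies in the support, then so does each member with positive
  weight: its negative is, up to scaling, the negated combination plus the other terms.\<close>

lemma qm_hull_support:
  assumes N: "quadratic_module N" and G: "\<And>g. g \<in> G \<Longrightarrow> affpoly g \<in> N"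
    and z: "z \<in> convex hull G" "affpoly (- z) \<in> N"
  obtains g where "g \<in> G" "affpoly (- g) \<in> N"
proof -
  \<comment> \<open>\<open>R\<close> replaces explicit combinations: its elements split off a
    positive multiple of some generator and stay in \<open>N\<close>. It is convex and contains
    \<open>G\<close>.\<close>
  define R where "R = {z. affpoly z \<in> N \<and> (\<exists>g\<in>G. \<exists>r>0. affpoly (z - r *\<^sub>R g) \<in> N)}"
  \<comment> \<open>Only \<open>a\<close> must be positive, as the generator split off from
    \<open>y\<close> is kept; for \<open>a = 0\<close> the combination is \<open>z\<close>
    itself.\<close>
  have comb: "a *\<^sub>R y + b *\<^sub>R z \<in> R" if "y \<in> R" "z \<in> R" "0 < a" "0 \<le> b" for a b y z
  proof -
    obtain g r where g: "g \<in> G" "0 < r" "affpoly (y - r *\<^sub>R g) \<in> N"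
      using \<open>y \<in> R\<close> by (auto simp: R_def)
    have N': "affpoly y \<in> N" "affpoly z \<in> N"
      using that by (auto simp: R_def)
    have "affpoly (a *\<^sub>R (y - r *\<^sub>R g) + b *\<^sub>R z) \<in> N"
      unfolding affpoly_add affpoly_scaleR
      using that N' g by (intro qm_add[OF N] qm_scale[OF N]) auto
    then have "affpoly (a *\<^sub>R y + b *\<^sub>R z - (a * r) *\<^sub>R g) \<in> N"
      by (simp add: algebra_simps)
    moreover have "affpoly (a *\<^sub>R y + b *\<^sub>R z) \<in> N"
      unfolding affpoly_add affpoly_scaleR
      using that N' by (intro qm_add[OF N] qm_scale[OF N]) auto
    ultimately show ?thesis
      unfolding R_def using g(1) mult_pos_pos[OF \<open>0 < a\<close> g(2)] by blast
  qed
  have "convex R"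
  proof (rule convexI)
    fix y z and a b :: real assume *: "y \<in> R" "z \<in> R" "0 \<le> a" "0 \<le> b" "a + b = 1"
    show "a *\<^sub>R y + b *\<^sub>R z \<in> R"
    proof (cases "a = 0")
      case True
      then show ?thesis using * by simp
    qed (use * comb in simp)
  qed
  moreover have "G \<subseteq> R"
    unfolding R_def using G qm_0[OF N] by (auto intro!: bexI exI[of _ 1])
  ultimately have "z \<in> R"
    using z(1) hull_minimal[of G R convex] by blast
  then obtain g r where g: "g \<in> G" "0 < r" "affpoly (z - r *\<^sub>R g) \<in> N"
    by (auto simp: R_def)
  have "pconst (1 / r) * (affpoly (z - r *\<^sub>R g) + affpoly (- z)) \<in> N"
    using g z by (intro qm_scale[OF N] qm_add[OF N]) auto
  also have "pconst (1 / r) * (affpoly (z - r *\<^sub>R g) + affpoly (- z)) = affpoly (- g)"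
    using g(2) by (simp flip: affpoly_add affpoly_scaleR)
  finally show thesis
    using that g(1) by blast
qed

definition aff_support :: "('n::finite) rpoly set \<Rightarrow> (real \<times> (real ^ 'n)) set" where
  "aff_support N = {z. affpoly z \<in> N \<and> affpoly (- z) \<in> N}"

lemma subspace_aff_support:
  assumes N: "quadratic_module N"
  shows "subspace (aff_support N)"
proof (rule subspaceI)
  show "0 \<in> aff_support N"
    by (simp add: aff_support_def qm_0[OF N])
next
  fix x y assume "x \<in> aff_support N" "y \<in> aff_support N"
  then show "x + y \<in> aff_support N"
    using qm_add[OF N, of "affpoly x" "affpoly y"] qm_add[OF N, of "affpoly (- x)" "affpoly (- y)"]
    by (simp add: aff_support_def flip: affpoly_add)
next
  fix c x assume x: "x \<in> aff_support N"
  have *: "pconst c * affpoly x \<in> N" if "x \<in> aff_support N" for c x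
    using that by (intro qm_support_mult[OF N]) (simp_all add: aff_support_def affpoly_uminus)
  show "c *\<^sub>R x \<in> aff_support N"
    using *[OF x, of c] *[OF x, of "- c"]
    by (simp add: aff_support_def affpoly_scaleR affpoly_uminus pconst_uminus)
qed

text \<open>If the two sets were disjoint, a functional strictly separating the compact hull from
  \<open>L\<close> would, once rescaled, be evaluation at a point excluded by infeasibility.\<close>

lemma hull_meets_subspace:
  fixes A :: "('n::finite) rpoly ^ 'a ^ 'a::finite"
  assumes A: "linear_pencil A" and U: "subspace U" and L: "subspace L"
    and infeasible: "\<And>x. (\<And>z. z \<in> L \<Longrightarrow> z \<bullet> (1, x) = 0) \<Longrightarrow>
      (\<And>u. u \<in> U \<Longrightarrow> 0 \<le> aform A u u \<bullet> (1, x)) \<Longrightarrow> False"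
  shows "convex hull (insert (1, 0) ((\<lambda>u. aform A u u) ` (U \<inter> sphere 0 1))) \<inter> L \<noteq> {}"
    (is "convex hull ?G \<inter> L \<noteq> {}")
proof
  assume disj: "convex hull ?G \<inter> L = {}"
  have "continuous_on (U \<inter> sphere 0 1) (\<lambda>u. aform A u u)"
    unfolding aform_def by (intro continuous_intros)
  moreover have "compact (U \<inter> sphere 0 1)"
    using closed_subspace[OF U] by (intro closed_Int_compact) auto
  ultimately have "compact (convex hull ?G)"
    by (intro compact_convex_hull compact_insert compact_continuous_image)
  then have "\<exists>y b. (\<forall>z\<in>convex hull ?G. y \<bullet> z < b) \<and> (\<forall>z\<in>L. b < y \<bullet> z)"
    using disj
    by (intro separating_hyperplane_compact_closed convex_convex_hull subspace_imp_convex[OF L]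
        closed_subspace[OF L]) simp_all
  then obtain y b where yb:
    "\<forall>z\<in>convex hull ?G. y \<bullet> z < b" "\<forall>z\<in>L. b < y \<bullet> z"
    by blast
  note y = yb(1)[rule_format] and b = yb(2)[rule_format]
  have "b < 0"
    using b[of 0] subspace_0[OF L] by simp
  \<comment> \<open>A nonzero value on the subspace could be scaled to equal \<open>b\<close>,
    against strict separation.\<close>
  have yL: "y \<bullet> z = 0" if "z \<in> L" for z
  proof (rule ccontr)
    assume "y \<bullet> z \<noteq> 0"
    then have "y \<bullet> ((b / (y \<bullet> z)) *\<^sub>R z) = b" by simp
    then show False
      using b[OF subspace_scale[OF L that]] by (metis less_irrefl)
  qed
  have yG: "y \<bullet> g < 0" if "g \<in> ?G" for g
    using y[OF hull_inc[of g ?G convex, OF that]] \<open>b < 0\<close> by linarith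
  have t: "fst y < 0"
    using yG[of "(1, 0)"] by (simp add: inner_prod_def)
  \<comment> \<open>Dividing by the negative number \<open>fst y\<close> turns the functional into
    evaluation at \<open>x\<close> and reverses the sign on the generators.\<close>
  define x where "x = (1 / fst y) *\<^sub>R snd y"
  have x: "(1, x) = (1 / fst y) *\<^sub>R y"
    using t by (simp add: x_def prod_eq_iff)
  have "0 \<le> aform A u u \<bullet> (1, x)" if "u \<in> U" for u
  proof (cases "u = 0")
    case True
    then show ?thesis by (simp add: aform_def)
  next
    case False
    let ?u = "(1 / norm u) *\<^sub>R u"
    have "?u \<in> U \<inter> sphere 0 1"
      using False subspace_scale[OF U that] by auto
    then have "y \<bullet> aform A ?u ?u < 0"
      by (intro yG) blast
    then have "y \<bullet> aform A u u < 0"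
      using False by (simp add: aform_scaleR_left aform_scaleR_right divide_less_0_iff mult_less_0_iff)
    then show ?thesis
      using t by (simp add: x inner_commute divide_nonpos_nonpos)
  qed
  then show False
    using infeasible[of x] yL by (simp add: x inner_commute)
qed

lemma dim_strict_subspace:
  fixes U V :: "'a::euclidean_space set"
  assumes "subspace U" "subspace V" "U \<subset> V"
  shows "dim U < dim V"
proof -
  have "span U \<subset> span V"
    unfolding span_eq_iff[THEN iffD2, OF assms(1)] span_eq_iff[THEN iffD2, OF assms(2)] by fact
  then show ?thesis
    by (rule dim_psubset)
qed

text \<open>The quadratic module and the subspace of test vectors vary together: each step either
  enlarges the affine part of the support of \<open>N\<close> or shrinks \<open>U\<close>.\<close>

lemma infeasible_imp_minus_one:
  fixes A :: "('n::finite) rpoly ^ 'a ^ 'a::finite" and U :: "(real ^ 'a) set"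
  assumes A: "linear_pencil A"
  assumes "quadratic_module N" "pencil_module A \<subseteq> N" "subspace U"
    and "\<nexists>x. (\<forall>z\<in>aff_support N. z \<bullet> (1, x) = 0) \<and> (\<forall>u\<in>U. 0 \<le> aform A u u \<bullet> (1, x))"
  shows "- 1 \<in> N"
  using assms(2-)
\<comment> \<open>The measure is the dimension of \<open>U\<close> plus the codimension of the
  affine support.\<close>
proof (induction "dim U + (DIM(real \<times> (real ^ 'n)) - dim (aff_support N))" arbitrary: U N
    rule: less_induct)
  case less
  note N = less.prems(1) and M = less.prems(2) and U = less.prems(3)
  define G where "G = insert (1, 0) ((\<lambda>u. aform A u u) ` (U \<inter> sphere 0 1))"
  note L = subspace_aff_support[OF N]
  have GN: "affpoly g \<in> N" if "g \<in> G" for g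
    using that M aform_diag_in_pencil_module[OF A] qm_1[OF N] by (auto simp: G_def)
  have "convex hull G \<inter> aff_support N \<noteq> {}"
    unfolding G_def using less.prems(4) by (intro hull_meets_subspace[OF A U L]) blast
  then obtain z where "z \<in> convex hull G" "affpoly (- z) \<in> N"
    by (auto simp: aff_support_def)
  then obtain g where g: "g \<in> G" "affpoly (- g) \<in> N"
    using qm_hull_support[OF N GN] by blast
  show ?case
  proof (cases "g = (1, 0)")
    case True
    then show ?thesis
      using g(2) by (simp only: affpoly_uminus affpoly_const pconst_1)
  next
    case False
    then obtain u where u: "g = aform A u u" "u \<in> U" "norm u = 1"
      using g(1) by (auto simp: G_def)
    have uu: "aform A u u \<in> aff_support N"
      using g GN u by (auto simp: aff_support_def)
    show ?thesis
    \<comment> \<open>On the zero set of the support, the first case makes \<open>u\<close>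
      orthogonal to \<open>U\<close> for the form, so the orthogonal complement of \<open>u\<close>
      in \<open>U\<close> suffices for testing.\<close>
    proof (cases "\<forall>w\<in>U. aform A u w \<in> aff_support N")
      case True
      define V where "V = U \<inter> {w. u \<bullet> w = 0}"
      have V: "subspace V"
        unfolding V_def by (intro subspace_inter U subspace_hyperplane)
      have "u \<notin> V"
        using u(3) by (auto simp: V_def)
      then have "V \<subset> U"
        using u(2) unfolding V_def by blast
      then have "dim V < dim U"
        by (rule dim_strict_subspace[OF V U])
      moreover have "0 \<le> aform A v v \<bullet> (1, x)"
        if x: "\<forall>z\<in>aff_support N. z \<bullet> (1, x) = 0" "\<forall>w\<in>V. 0 \<le> aform A w w \<bullet> (1, x)"
          and v: "v \<in> U" for x v
      proof -
        define r where "r = u \<bullet> v"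
        define w where "w = v - r *\<^sub>R u"
        have "w \<in> U"
          unfolding w_def by (intro subspace_diff[OF U v] subspace_scale[OF U u(2)])
        moreover have "u \<bullet> w = 0"
          using u(3) by (simp add: w_def r_def inner_diff_right dot_square_norm)
        ultimately have "w \<in> V"
          by (simp add: V_def)
        have "v = w + r *\<^sub>R u"
          by (simp add: w_def)
        then have "aform A v v =
            aform A w w + r *\<^sub>R aform A u w + (r *\<^sub>R aform A u w + (r * r) *\<^sub>R aform A u u)"
          by (simp only: aform_add_left aform_add_right aform_scaleR_left aform_scaleR_right
              aform_commute[OF A, of w u] scaleR_scaleR scaleR_add_right)
        moreover have "aform A u w \<bullet> (1, x) = 0" "aform A u u \<bullet> (1, x) = 0"
          using x(1) True \<open>w \<in> U\<close> uu by blast+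
        ultimately have "aform A v v \<bullet> (1, x) = aform A w w \<bullet> (1, x)"
          by (simp only: inner_add_left inner_scaleR_left mult_zero_right add_0_right)
        then show ?thesis
          using x(2) \<open>w \<in> V\<close> by simp
      qed
      ultimately show ?thesis
        using less.prems(4) by (intro less.hyps[of V N, OF _ N M V]) (simp, blast)
    next
      case False
      then obtain w where w: "w \<in> U" "aform A u w \<notin> aff_support N"
        by blast
      define l where "l = affpoly (aform A u w)"
      define N' where "N' = {f + p * l | f p. f \<in> N}"
      have N': "quadratic_module N'"
        unfolding N'_def by (rule quadratic_module_adjoin[OF N])
      have N'I: "f + p * l \<in> N'" if "f \<in> N" for f p
        using that by (auto simp: N'_def)
      have sub: "N \<subseteq> N'"
        using N'I[of _ 0] by auto
      have "aform A u w \<in> aff_support N'"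
        using N'I[OF qm_0[OF N], of 1] N'I[OF qm_0[OF N], of "- 1"]
        by (simp add: aff_support_def affpoly_uminus l_def)
      moreover have subL: "aff_support N \<subseteq> aff_support N'"
        using sub by (auto simp: aff_support_def)
      ultimately have "dim (aff_support N) < dim (aff_support N')"
        using w(2) by (intro dim_strict_subspace L subspace_aff_support[OF N']) blast
      \<comment> \<open>This bound makes the truncated subtraction in the measure strictly
        decrease.\<close>
      moreover have "dim (aff_support N') \<le> DIM(real \<times> (real ^ 'n))"
        by (rule dim_subset_UNIV)
      \<comment> \<open>Infeasibility persists, as a larger support has a smaller zero set.\<close>
      ultimately have "- 1 \<in> N'"
        using less.prems(4) sub M subL
        by (intro less.hyps[of U N', OF _ N' _ U]) (linarith, blast, blast)
      then obtain f p where "- 1 = f + p * l" "f \<in> N"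
        by (auto simp: N'_def)
      then have "- 1 - p * l \<in> N"
        by (metis add_diff_cancel_right')
      moreover have "affpoly (aform A w w) + h * l \<in> N" for h
      proof -
        \<comment> \<open>With weights \<open>h/2\<close> on \<open>u\<close> and 1 on
          \<open>w\<close>, the cross term is exactly \<open>h * l\<close>; the
          \<open>u^T A u\<close> term is removed because its negative is in
          \<open>N\<close>.\<close>
        let ?h = "pconst (1/2) * h"
        have "?h\<^sup>2 * affpoly (aform A u u) + 2 * ?h * 1 * l + 1\<^sup>2 * affpoly (aform A w w) \<in> N"
          using aform_in_pencil_module[OF A] M unfolding l_def by blast
        moreover have "?h\<^sup>2 * affpoly (- aform A u u) \<in> N"
          using uu by (intro qm_square_mult[OF N]) (simp add: aff_support_def)
        ultimately have "?h\<^sup>2 * affpoly (aform A u u) + 2 * ?h * 1 * l + 1\<^sup>2 * affpoly (aform A w w)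
            + ?h\<^sup>2 * affpoly (- aform A u u) \<in> N"
          by (rule qm_add[OF N])
        also have "?h\<^sup>2 * affpoly (aform A u u) + 2 * ?h * 1 * l + 1\<^sup>2 * affpoly (aform A w w)
            + ?h\<^sup>2 * affpoly (- aform A u u)
            = affpoly (aform A w w) + (pconst (1/2) + pconst (1/2)) * h * l"
          by (simp add: affpoly_uminus algebra_simps)
        finally show ?thesis
          by (simp only: pconst_half mult_1)
      qed
      ultimately show ?thesis
        by (rule qm_eliminate[OF N])
    qed
  qed
qed

section \<open>Bounded spectrahedra\<close>

text \<open>Weak separation of \<open>f\<close> from the cone of affine members suffices, because
  \<open>f\<close> is strictly positive on the spectrahedron.\<close>

lemma affine_pos_in_pencil_module:
  fixes A :: "('n::finite) rpoly ^ 'a ^ 'a::finite"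
  assumes A: "linear_pencil A" and bdd: "bounded (spectrahedron A)"
    and x0: "x0 \<in> spectrahedron A"
    and pos: "\<And>x. x \<in> spectrahedron A \<Longrightarrow> 0 < f \<bullet> (1, x)"
  shows "affpoly f \<in> pencil_module A"
proof (rule ccontr)
  assume f: "affpoly f \<notin> pencil_module A"
  note M = quadratic_module_pencil_module[of A]
  define C where "C = {z. affpoly z \<in> pencil_module A}"
  have scale: "r *\<^sub>R z \<in> C" if "z \<in> C" "0 \<le> r" for z r
    using that qm_scale[OF M] by (simp add: C_def affpoly_scaleR)
  have "convex C"
    using scale qm_add[OF M] by (intro convexI) (simp add: C_def affpoly_add)
  have "0 \<in> C"
    using qm_0[OF M] by (simp add: C_def)
  have "{f} \<inter> C = {}"
    using f by (simp add: C_def)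
  then obtain a b where a: "a \<noteq> 0" "a \<bullet> f \<le> b" and b: "\<And>z. z \<in> C \<Longrightarrow> b \<le> a \<bullet> z"
    using separating_hyperplane_sets[of "{f}" C] \<open>convex C\<close> \<open>0 \<in> C\<close>
    by (metis convex_singleton empty_iff insert_not_empty singletonI)
  have "b \<le> 0"
    using b[OF \<open>0 \<in> C\<close>] by simp
  \<comment> \<open>A functional bounded below on a cone is nonnegative there: a negative value
    could be scaled down to \<open>b - 1\<close>.\<close>
  have aC: "0 \<le> a \<bullet> z" if "z \<in> C" for z
  proof (rule ccontr)
    assume neg: "\<not> 0 \<le> a \<bullet> z"
    then have "0 \<le> (b - 1) / (a \<bullet> z)"
      using \<open>b \<le> 0\<close> by (simp add: divide_nonpos_nonpos)
    then have "b \<le> a \<bullet> (((b - 1) / (a \<bullet> z)) *\<^sub>R z)"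
      by (intro b scale that)
    then show False
      using neg by simp
  qed
  have aA: "0 \<le> aform A u u \<bullet> a" for u
    using aC[of "aform A u u"] aform_diag_in_pencil_module[OF A]
    by (simp add: C_def inner_commute)
  have "0 \<le> fst a"
    using aC[of "(1, 0)"] qm_1[OF M] by (simp add: C_def inner_prod_def)
  then consider "0 < fst a" | "fst a = 0" by linarith
  then show False
  proof cases
    case 1
    define x where "x = (1 / fst a) *\<^sub>R snd a"
    have x: "(1, x) = (1 / fst a) *\<^sub>R a"
      using 1 by (simp add: x_def prod_eq_iff)
    have "x \<in> spectrahedron A"
      using 1 aA by (simp add: spectrahedron_iff[OF A] x)
    moreover have "f \<bullet> (1, x) \<le> 0"
      using a(2) \<open>b \<le> 0\<close> 1 by (simp add: x inner_commute divide_nonpos_pos)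
    ultimately show False
      using pos by fastforce
  next
    case 2
    have in_S: "x0 + s *\<^sub>R snd a \<in> spectrahedron A" if "0 \<le> s" for s
    proof -
      have "(1, x0 + s *\<^sub>R snd a) = (1, x0) + s *\<^sub>R a"
        using 2 by (simp add: prod_eq_iff)
      then show ?thesis
        using x0 aA that by (simp add: spectrahedron_iff[OF A] inner_add_right)
    qed
    obtain B where B: "\<And>x. x \<in> spectrahedron A \<Longrightarrow> norm x \<le> B"
      using bdd by (auto simp: bounded_iff)
    have nz: "norm (snd a) \<noteq> 0"
      using a(1) 2 by (simp add: prod_eq_iff)
    \<comment> \<open>The displacement gets norm \<open>B + norm x0 + 1\<close>, more than two
      points of norm at most \<open>B\<close> and \<open>norm x0\<close> can be apart.\<close>
    define s where "s = (B + norm x0 + 1) / norm (snd a)"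
    have "0 \<le> B"
      using B[OF x0] norm_ge_zero[of x0] by linarith
    then have "0 \<le> s"
      by (simp add: s_def)
    have "norm (s *\<^sub>R snd a) = B + norm x0 + 1"
      using nz \<open>0 \<le> B\<close> by (simp add: s_def)
    then show False
      using B[OF in_S[OF \<open>0 \<le> s\<close>]] norm_triangle_ineq4[of "x0 + s *\<^sub>R snd a" x0] by simp
  qed
qed

lemma bounded_imp_archimedean:
  assumes A: "linear_pencil A" and bdd: "bounded (spectrahedron A)"
  shows "archimedean (pencil_module A)"
proof -
  note M = quadratic_module_pencil_module[of A]
  show ?thesis
  proof (cases "spectrahedron A = {}")
    case True
    \<comment> \<open>The induction starts at the pencil module itself with all test
      vectors.\<close>
    then have "- 1 \<in> pencil_module A"
      by (intro infeasible_imp_minus_one[OF A M order_refl subspace_UNIV])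
        (simp flip: spectrahedron_iff[OF A])
    then show ?thesis
      using M qm_eq_UNIV[OF M] by (simp add: archimedean_def)
  next
    case False
    then obtain x0 where x0: "x0 \<in> spectrahedron A" by blast
    obtain B where B: "\<And>x. x \<in> spectrahedron A \<Longrightarrow> norm x \<le> B"
      using bdd by (auto simp: bounded_iff)
    have comp: "\<bar>x $ i\<bar> \<le> B" if "x \<in> spectrahedron A" for x i
      using B[OF that] component_le_norm_cart[of x i] by linarith
    \<comment> \<open>The extra 1 makes \<open>B + 1\<close> plus or minus a coordinate strictly
      positive on the spectrahedron.\<close>
    have "affpoly (B + 1, axis i r) \<in> pencil_module A" if "r = 1 \<or> r = - 1" for i r
    proof (rule affine_pos_in_pencil_module[OF A bdd x0])
      fix x assume "x \<in> spectrahedron A"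
      then show "0 < (B + 1, axis i r) \<bullet> (1, x)"
        using comp[of x i] that by (auto simp: inner_axis' )
    qed
    from this[of 1] this[of "- 1"] show ?thesis
      by (intro archimedeanI_pvar[OF M] qm_boundedI[OF M, of "B + 1" _ "B + 1"])
        (simp_all add: affpoly_axis pconst_uminus)
  qed
qed

text \<open>Members of the module are nonnegative on the spectrahedron, so certificates for each
  variable and its negative confine every coordinate.\<close>

lemma archimedean_imp_bounded:
  assumes "archimedean (pencil_module A)"
  shows "bounded (spectrahedron A)"
proof -
  have "\<exists>k::nat. of_nat k + f \<in> pencil_module A" for f
    using assms by (simp add: archimedean_def)
  then obtain k :: "_ \<Rightarrow> nat" where k: "of_nat (k f) + f \<in> pencil_module A" for f
    by metis
  \<comment> \<open>The sum of the two one-sided bounds, both nonnegative, dominates the absolute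
    value.\<close>
  define b where "b i = real (k (pvar i)) + real (k (- pvar i))" for i
  have le: "- peval f x \<le> real (k f)" if "x \<in> spectrahedron A" for f x
    using pencil_module_nonneg[OF that k[of f]] by (simp flip: pconst_of_nat)
  have "norm x \<le> (\<Sum>i\<in>UNIV. b i)" if "x \<in> spectrahedron A" for x
  proof -
    have "\<bar>x $ i\<bar> \<le> b i" for i
      using le[OF that, of "pvar i"] le[OF that, of "- pvar i"] by (simp add: b_def)
    then show ?thesis
      using norm_le_l1_cart[of x] by (meson order_trans sum_mono)
  qed
  then show ?thesis
    by (auto simp: bounded_iff)
qed

theorem corollary4p4p2:
  fixes A :: "('n::finite) rpoly ^ 'a::finite ^ 'a"
  assumes "linear_pencil A"
  shows "bounded (spectrahedron A) \<longleftrightarrow> archimedean (pencil_module A)"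
  using bounded_imp_archimedean[OF assms] archimedean_imp_bounded by blast

end
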